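(* Let $n\geq 1$ be an integer and let $\rho$ be a metric on $\mathbb{R}^n$ which induces the Euclidean topology on $\mathbb{R}^n$. Then $\mathcal{H}^n_\rho(\mathbb{R}^n)>0$.
   Context: For a metric space $(X,\mathrm{d})$, a positive integer $n$ and a subset $A\subseteq X$, the $n$-dimensional Hausdorff outer measure of $A$ (without any normalizing dimensional constant) is $$\mathcal{H}^n_{\mathrm{d}}(A):=\sup_{\delta>0}\mathcal{H}^n_{\delta,\mathrm{d}}(A),\qquad \mathcal{H}^n_{\delta,\mathrm{d}}(A):=\inf\Bigl\{\sum_{i\in I}\operatorname{diam}(A_i)^n\;:\;A\subseteq\bigcup_{i\in I}A_i,\ \operatorname{diam}(A_i)\leq\delta \text{ for all } i\in I\Bigr\},$$ where the infimum is over all at most countable families $(A_i)_{i\in I}$ of subsets of $X$, and $\operatorname{diam}(U)=\sup_{x,y\in U}\mathrm{d}(x,y)$ (with $\operatorname{diam}(\emptyset)=0$). The value may be $+\infty$. *)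

theory Defs
  imports "HOL-Analysis.Analysis"
begin

text \<open>
  The diameter is an extended nonnegative real: it is \<open>\<infinity>\<close> on unbounded sets, and
  \<open>0\<close> on the empty set because the supremum of \<open>{}\<close> in \<^typ>\<open>ennreal\<close> is \<open>0\<close>.
\<close>

definition ediam :: "('a \<Rightarrow> 'a \<Rightarrow> real) \<Rightarrow> 'a set \<Rightarrow> ennreal" where
  "ediam d U = (SUP (x, y) \<in> U \<times> U. ennreal (d x y))"

text \<open>
  \<open>M\<close> is the carrier of the metric space and \<open>d\<close> its metric. The at most countable index
  sets are taken to be the (finite or infinite) sets of natural numbers. No normalizing
  constant is used. Infinite sums in \<^typ>\<open>ennreal\<close> always exist, and
  \<^term>\<open>Inf {} = (\<infinity> :: ennreal)\<close> is the value if there is no admissible cover.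
\<close>

definition hausdorff_pre_measure ::
    "'a set \<Rightarrow> ('a \<Rightarrow> 'a \<Rightarrow> real) \<Rightarrow> nat \<Rightarrow> real \<Rightarrow> 'a set \<Rightarrow> ennreal" where
  "hausdorff_pre_measure M d n \<delta> A =
     Inf {(\<Sum>\<^sub>\<infinity>i\<in>I. ediam d (C i) ^ n) | (I :: nat set) (C :: nat \<Rightarrow> 'a set).
            (\<forall>i\<in>I. C i \<subseteq> M) \<and> A \<subseteq> (\<Union>i\<in>I. C i) \<and> (\<forall>i\<in>I. ediam d (C i) \<le> ennreal \<delta>)}"

definition hausdorff_outer_measure ::
    "'a set \<Rightarrow> ('a \<Rightarrow> 'a \<Rightarrow> real) \<Rightarrow> nat \<Rightarrow> 'a set \<Rightarrow> ennreal" where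
  "hausdorff_outer_measure M d n A = (SUP \<delta>\<in>{0<..}. hausdorff_pre_measure M d n \<delta> A)"

end

theory Submission
  imports Defs
begin

text \<open>
  Scaled and truncated \<open>\<rho>\<close>-distances to the \<open>n\<close> faces \<open>x\<^sub>i = 0\<close> of the unit cube are the
  coordinates of a map \<open>G\<close> that is Lipschitz from \<open>\<rho>\<close> to the maximum norm and takes every
  face of the cube into itself. Brouwer's theorem makes such a map cover the cube. A cover of
  \<open>\<real>\<^sup>n\<close> by sets of \<open>\<rho>\<close>-diameter \<open>D\<^sub>k\<close> thus gives a cover of the unit cube by cubes
  with sides proportional to \<open>D\<^sub>k\<close>, so that Lebesgue measure bounds \<open>\<Sum> D\<^sub>k\<^sup>n\<close> from below.
\<close>

text \<open>A preimage of \<open>y\<close> is a fixed point of the map sending \<open>x\<close> to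
  \<open>x - g x + y\<close>, up to clamping each coordinate to the unit interval. Brouwer's theorem
  yields a fixed point of the clamped map, and the face conditions undo the clamping.\<close>

lemma unit_cube_subset_image_of_face_preserving:
  fixes g :: "real ^ 'n \<Rightarrow> real ^ 'n"
  assumes cont: "continuous_on (cbox 0 1) g"
    and face0: "\<And>x i. x \<in> cbox 0 1 \<Longrightarrow> x $ i = 0 \<Longrightarrow> g x $ i = 0"
    and face1: "\<And>x i. x \<in> cbox 0 1 \<Longrightarrow> x $ i = 1 \<Longrightarrow> g x $ i = 1"
  shows "cbox 0 1 \<subseteq> g ` cbox 0 1"
proof
  fix y :: "real ^ 'n" assume y: "y \<in> cbox 0 1"
  define h where "h x = (\<chi> i. max 0 (min 1 (x $ i - g x $ i + y $ i)))" for x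
  have "continuous_on (cbox 0 1) h"
    unfolding h_def using cont by (intro continuous_intros)
  moreover have "h \<in> cbox 0 1 \<rightarrow> cbox 0 1"
    by (auto simp: h_def mem_box_cart)
  moreover have "cbox (0 :: real ^ 'n) 1 \<noteq> {}"
    using y by blast
  ultimately obtain x where x: "x \<in> cbox 0 1" "h x = x"
    using brouwer[OF compact_cbox convex_box(1)] by blast
  have "g x $ i = y $ i" for i
  proof -
    have clamp: "max 0 (min 1 (x $ i - g x $ i + y $ i)) = x $ i"
      using arg_cong[OF x(2), of "\<lambda>v. v $ i"] by (simp add: h_def)
    have "0 \<le> y $ i" "y $ i \<le> 1"
      using y by (auto simp: mem_box_cart)
    moreover have "x $ i = 0 \<Longrightarrow> g x $ i = 0" "x $ i = 1 \<Longrightarrow> g x $ i = 1"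
      using face0 face1 x(1) by auto
    ultimately show ?thesis
      \<comment> \<open>If \<open>x $ i\<close> lies strictly between 0 and 1, the clamp is inactive
        and the equation gives the claim. If it is 0 or 1, it cancels against \<open>g x $ i\<close>
        and the clamped value is just \<open>y $ i\<close>.\<close>
      using clamp by linarith
  qed
  then have "y = g x"
    by (simp add: vec_eq_iff)
  then show "y \<in> g ` cbox 0 1"
    using x(1) by blast
qed

text \<open>A covering set of diameter \<open>D\<close> is mapped by \<open>F\<close> into a cube of
  side \<open>2 * (D / L)\<close>, whose volume times \<open>(L / 2) ^ CARD('n)\<close> is
  \<open>D ^ CARD('n)\<close>. Countable subadditivity of Lebesgue measure then sums these
  bounds.\<close>

lemma emeasure_lborel_le_hausdorff_pre_measure:
  fixes F :: "'a \<Rightarrow> real ^ 'n"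
  assumes L: "0 < L"
    and lip: "\<And>x y i. x \<in> M \<Longrightarrow> y \<in> M \<Longrightarrow> \<bar>F x $ i - F y $ i\<bar> \<le> d x y / L"
    and sub: "S \<subseteq> F ` A"
  shows "ennreal ((L / 2) ^ CARD('n)) * emeasure lborel S \<le> hausdorff_pre_measure M d CARD('n) \<delta> A"
  unfolding hausdorff_pre_measure_def
proof (rule Inf_greatest, clarify)
  fix I :: "nat set" and C :: "nat \<Rightarrow> 'a set"
  assume CM: "\<forall>i\<in>I. C i \<subseteq> M" and cov: "A \<subseteq> (\<Union>i\<in>I. C i)"
    and diam: "\<forall>i\<in>I. ediam d (C i) \<le> ennreal \<delta>"
  let ?e = "\<lambda>k. if k \<in> I then ediam d (C k) ^ CARD('n) else 0"
  have "\<exists>B \<in> sets lborel. F ` C k \<subseteq> B \<and>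
      ennreal ((L / 2) ^ CARD('n)) * emeasure lborel B \<le> ediam d (C k) ^ CARD('n)" if k: "k \<in> I" for k
  proof (cases "C k = {}")
    case True
    then show ?thesis by (intro bexI[of _ "{}"]) auto
  next
    case False
    then obtain p where p: "p \<in> C k" by blast
    \<comment> \<open>The bound by \<open>\<delta>\<close> serves to make the diameter a real
      number.\<close>
    have "ediam d (C k) < top"
      using diam k by (auto intro: le_less_trans)
    then obtain D where D: "0 \<le> D" "ediam d (C k) = ennreal D"
      by (cases "ediam d (C k)") auto
    have dD: "d x p \<le> D" if "x \<in> C k" for x
    proof -
      have "ennreal (d x p) \<le> ediam d (C k)"
        unfolding ediam_def using that p by (intro SUP_upper2[of "(x, p)"]) auto
      then show ?thesis using D by simp
    qed
    define r :: "real ^ 'n" where "r = (\<chi> i. D / L)"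
    have "F ` C k \<subseteq> cbox (F p - r) (F p + r)"
    proof clarify
      fix x assume x: "x \<in> C k"
      have "\<bar>F x $ i - F p $ i\<bar> \<le> D / L" for i
      proof -
        have "\<bar>F x $ i - F p $ i\<bar> \<le> d x p / L"
          using lip[of x p] x p CM k by blast
        also have "\<dots> \<le> D / L"
          using dD[OF x] L by (simp add: divide_right_mono)
        finally show ?thesis .
      qed
      then have "F p $ i - D / L \<le> F x $ i" "F x $ i \<le> F p $ i + D / L" for i
        unfolding abs_le_iff by (smt (verit))+
      then show "F x \<in> cbox (F p - r) (F p + r)"
        by (simp add: mem_box_cart r_def)
    qed
    moreover have "emeasure lborel (cbox (F p - r) (F p + r)) = ennreal ((2 * (D / L)) ^ CARD('n))"
    proof -
      have "((F p + r) - (F p - r)) \<bullet> b = 2 * (D / L)" and "(F p - r) \<bullet> b \<le> (F p + r) \<bullet> b"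
        if "b \<in> Basis" for b :: "real ^ 'n"
        using that D L by (auto simp: Basis_vec_def inner_axis r_def)
      then show ?thesis
        by (simp add: emeasure_lborel_cbox_eq)
    qed
    then have "ennreal ((L / 2) ^ CARD('n)) * emeasure lborel (cbox (F p - r) (F p + r)) =
        ediam d (C k) ^ CARD('n)"
      using D L by (simp flip: ennreal_mult power_mult_distrib add: ennreal_power)
    ultimately show ?thesis
      by (intro bexI[of _ "cbox (F p - r) (F p + r)"]) auto
  qed
  then obtain B where B: "\<And>k. k \<in> I \<Longrightarrow> B k \<in> sets lborel"
      "\<And>k. k \<in> I \<Longrightarrow> F ` C k \<subseteq> B k"
      "\<And>k. k \<in> I \<Longrightarrow> ennreal ((L / 2) ^ CARD('n)) * emeasure lborel (B k) \<le> ediam d (C k) ^ CARD('n)"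
    by metis
  define B' where "B' k = (if k \<in> I then B k else {})" for k
  have B': "range B' \<subseteq> sets lborel"
    using B(1) by (auto simp: B'_def)
  have "S \<subseteq> (\<Union>k. B' k)"
    using sub cov B(2) by (fastforce simp: B'_def)
  then have "emeasure lborel S \<le> emeasure lborel (\<Union>k. B' k)"
    using B' by (intro emeasure_mono) auto
  also have "\<dots> \<le> (\<Sum>k. emeasure lborel (B' k))"
    using B' by (rule emeasure_subadditive_countably)
  finally have "ennreal ((L / 2) ^ CARD('n)) * emeasure lborel S
      \<le> ennreal ((L / 2) ^ CARD('n)) * (\<Sum>k. emeasure lborel (B' k))"
    by (rule mult_left_mono) simp
  also have "\<dots> = (\<Sum>k. ennreal ((L / 2) ^ CARD('n)) * emeasure lborel (B' k))"
    by (rule ennreal_suminf_cmult[symmetric])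
  also have "\<dots> \<le> (\<Sum>k. ?e k)"
    using B(3) by (intro suminf_le) (auto simp: B'_def)
  \<comment> \<open>Extension by zero outside \<open>I\<close> links the series over all naturals,
    used for subadditivity, to the unordered sum over \<open>I\<close> in the definition.\<close>
  also have "\<dots> = (\<Sum>\<^sub>\<infinity>k. ?e k)"
    by (intro sums_unique[symmetric] has_sum_imp_sums has_sum_infsum nonneg_summable_on_complete) auto
  also have "\<dots> = (\<Sum>\<^sub>\<infinity>k\<in>I. ediam d (C k) ^ CARD('n))"
    by (intro infsum_cong_neutral) auto
  finally show "ennreal ((L / 2) ^ CARD('n)) * emeasure lborel S
      \<le> (\<Sum>\<^sub>\<infinity>k\<in>I. ediam d (C k) ^ CARD('n))" .
qed

lemma (in Metric_space) INF_dist_lipschitz: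
  assumes "F \<subseteq> M" "F \<noteq> {}" "x \<in> M" "y \<in> M"
  shows "\<bar>(INF z\<in>F. d x z) - (INF z\<in>F. d y z)\<bar> \<le> d x y"
proof -
  have le: "(INF z\<in>F. d u z) - d u v \<le> (INF z\<in>F. d v z)" if "u \<in> M" "v \<in> M" for u v
  proof (rule cINF_greatest[OF assms(2)])
    fix z assume z: "z \<in> F"
    have "(INF z\<in>F. d u z) \<le> d u z"
      using z by (intro cINF_lower bdd_belowI[of _ 0]) auto
    also have "\<dots> \<le> d u v + d v z"
      using that z assms(1) by (intro triangle) auto
    finally show "(INF z\<in>F. d u z) - d u v \<le> d v z" by simp
  qed
  show ?thesis
    using le[of x y] le[of y x] assms(3,4) commute[of x y] by auto
qed

text \<open>Balls of \<open>\<rho>\<close> are open in the given topology. This provides the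
  continuity that Brouwer's theorem asks for.\<close>

lemma continuous_on_of_metric_lipschitz:
  fixes \<rho> :: "'a :: topological_space \<Rightarrow> 'a \<Rightarrow> real" and f :: "'a \<Rightarrow> real"
  assumes "Metric_space UNIV \<rho>" and top: "Metric_space.mtopology UNIV \<rho> = euclidean"
    and lip: "\<And>x y. \<bar>f x - f y\<bar> \<le> \<rho> x y"
  shows "continuous_on S f"
proof -
  interpret Metric_space UNIV \<rho> by fact
  have "(f \<longlongrightarrow> f x) (at x)" for x
  proof (rule tendstoI)
    fix e :: real assume e: "0 < e"
    have "open (mball x e)"
      using openin_mball[of x e] top by simp
    then have "\<forall>\<^sub>F y in at x. y \<in> mball x e"
      using e by (intro eventually_at_in_open') auto
    then show "\<forall>\<^sub>F y in at x. dist (f y) (f x) < e"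
    proof eventually_elim
      case (elim y)
      then show ?case
        using lip[of x y] by (simp add: dist_real_def abs_minus_commute)
    qed
  qed
  then show ?thesis
    unfolding continuous_on_def by (blast intro: tendsto_within_subset)
qed

text \<open>The complement of \<open>F\<close> is open for \<open>\<rho>\<close> as well, so it
  contains a \<open>\<rho>\<close>-ball around \<open>x\<close>, whose radius bounds the infimum
  from below.\<close>

lemma INF_metric_pos:
  fixes \<rho> :: "'a :: topological_space \<Rightarrow> 'a \<Rightarrow> real"
  assumes "Metric_space UNIV \<rho>" and top: "Metric_space.mtopology UNIV \<rho> = euclidean"
    and F: "closed F" "F \<noteq> {}" "x \<notin> F"
  shows "0 < (INF z\<in>F. \<rho> x z)"
proof -
  interpret Metric_space UNIV \<rho> by fact
  have "openin mtopology (- F)"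
    using F(1) top by (simp add: open_Compl)
  then obtain e where e: "0 < e" "mball x e \<subseteq> - F"
    using F(3) unfolding openin_mtopology by blast
  have "e \<le> (INF z\<in>F. \<rho> x z)"
    using e(2) F(2) by (intro cINF_greatest) force+
  with e(1) show ?thesis by simp
qed

theorem theorem7:
  fixes \<rho> :: "real ^ 'n \<Rightarrow> real ^ 'n \<Rightarrow> real"
  assumes "Metric_space UNIV \<rho>"
    and "Metric_space.mtopology UNIV \<rho> = euclidean"
  shows "hausdorff_outer_measure UNIV \<rho> CARD('n) UNIV > 0"
proof -
  interpret Metric_space UNIV \<rho> by fact
  define face where "face t i = {x \<in> cbox (0 :: real ^ 'n) 1. x $ i = t}" for t i
  define f where "f i x = (INF z\<in>face 0 i. \<rho> x z)" for i x
  have vec_face: "vec t \<in> face t i" if "t \<in> {0, 1}" for t i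
    using that by (auto simp: face_def mem_box_cart)
  have compact_face: "compact (face t i)" for t i
    unfolding face_def Collect_conj_eq Collect_mem_eq
    by (intro compact_Int_closed compact_cbox closed_Collect_eq continuous_intros)
  have face_nonempty: "face 0 i \<noteq> {}" "face 1 i \<noteq> {}" for i
    using vec_face[of 0 i] vec_face[of 1 i] by auto
  have lip: "\<bar>f i x - f i y\<bar> \<le> \<rho> x y" for i x y
    unfolding f_def using face_nonempty by (intro INF_dist_lipschitz) auto
  have cont: "continuous_on S (f i)" for S i
    using continuous_on_of_metric_lipschitz[OF assms lip] .
  have f_face0: "f i x = 0" if "x \<in> face 0 i" for i x
  proof (rule antisym)
    show "f i x \<le> 0"
      unfolding f_def using that by (intro cINF_lower2[OF _ that] bdd_belowI[of _ 0]) auto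
    show "0 \<le> f i x"
      unfolding f_def using face_nonempty by (intro cINF_greatest) auto
  qed
  \<comment> \<open>By compactness \<open>f i\<close> attains its minimum on
    \<open>face 1 i\<close>, and the minimum is positive because the closed set
    \<open>face 0 i\<close> is disjoint from that face.\<close>
  have "\<exists>c>0. \<forall>x\<in>face 1 i. c \<le> f i x" for i
  proof -
    obtain p where p: "p \<in> face 1 i" "\<forall>x\<in>face 1 i. f i p \<le> f i x"
      using continuous_attains_inf[OF compact_face face_nonempty(2) cont] by blast
    have "0 < f i p"
      unfolding f_def using p(1) compact_face face_nonempty
      by (intro INF_metric_pos[OF assms]) (auto simp: face_def compact_imp_closed)
    with p(2) show ?thesis by blast
  qed
  then obtain c where c: "\<And>i. 0 < c i" "\<And>i x. x \<in> face 1 i \<Longrightarrow> c i \<le> f i x"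
    by metis
  \<comment> \<open>One scale for all coordinates; it is positive since there are finitely many of
    them.\<close>
  define L where "L = Min (range c)"
  have L: "0 < L" and Lc: "L \<le> c i" for i
    using c(1) by (auto simp: L_def)
  \<comment> \<open>On \<open>face 1 i\<close> the quotient is at least 1, so truncation makes the
    coordinate exactly 1 there. Truncation does not increase differences, so the Lipschitz bound
    survives.\<close>
  define G where "G x = (\<chi> i. min 1 (f i x / L))" for x
  have "cbox 0 1 \<subseteq> G ` cbox 0 1"
  proof (rule unit_cube_subset_image_of_face_preserving)
    show "continuous_on (cbox 0 1) G"
      unfolding G_def using L by (intro continuous_intros cont) auto
    show "G x $ i = 0" if "x \<in> cbox 0 1" "x $ i = 0" for x i
      using f_face0[of x i] that by (simp add: G_def face_def)
    show "G x $ i = 1" if "x \<in> cbox 0 1" "x $ i = 1" for x i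
      using order_trans[OF Lc c(2)[of x i]] that L by (simp add: G_def face_def)
  qed
  then have sub: "cbox 0 1 \<subseteq> G ` UNIV"
    by blast
  have "\<bar>G x $ i - G y $ i\<bar> \<le> \<rho> x y / L" for x y i
  proof -
    have "\<bar>G x $ i - G y $ i\<bar> \<le> \<bar>f i x / L - f i y / L\<bar>"
      by (simp add: G_def)
    also have "\<dots> = \<bar>f i x - f i y\<bar> / L"
      using L by (simp add: diff_divide_distrib[symmetric])
    also have "\<dots> \<le> \<rho> x y / L"
      using lip L by (simp add: divide_right_mono)
    finally show ?thesis .
  qed
  \<comment> \<open>The lower bound does not depend on \<open>\<delta>\<close>; the value 1 is an
    arbitrary choice below the supremum.\<close>
  then have "ennreal ((L / 2) ^ CARD('n)) * emeasure lborel (cbox (0 :: real ^ 'n) 1)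
      \<le> hausdorff_pre_measure UNIV \<rho> CARD('n) 1 UNIV"
    using emeasure_lborel_le_hausdorff_pre_measure[OF L _ sub] by blast
  also have "\<dots> \<le> hausdorff_outer_measure UNIV \<rho> CARD('n) UNIV"
    unfolding hausdorff_outer_measure_def by (intro SUP_upper) auto
  finally have "ennreal ((L / 2) ^ CARD('n)) * emeasure lborel (cbox (0 :: real ^ 'n) 1)
      \<le> hausdorff_outer_measure UNIV \<rho> CARD('n) UNIV" .
  moreover have "0 < emeasure lborel (cbox (0 :: real ^ 'n) 1)"
    by (auto simp: emeasure_lborel_cbox_eq Basis_vec_def inner_axis intro!: prod_pos)
  then have "0 < ennreal ((L / 2) ^ CARD('n)) * emeasure lborel (cbox (0 :: real ^ 'n) 1)"
    using L by (simp add: ennreal_zero_less_mult_iff)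
  ultimately show ?thesis
    by (rule less_le_trans[rotated])
qed

end
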